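(* Let $B$ and $R$ be $C_4$-free graphs with the same vertex set $V$, and assume that $G(B,R)$ is the complete graph on $V$. If $G(B,R)$ does not contain a double $C_5$, then $V$ is obedient.
   Context: All graphs are simple (no loops or multiple edges). For two graphs $B,R$ on the same vertex set $V$, $G(B,R)$ is the graph with vertex set $V$ in which two vertices are adjacent if they are adjacent in at least one of $B$ and $R$. A clique in a graph is a set of pairwise adjacent vertices (the empty set is allowed). A subset $U\subseteq V$ is obedient if there exist a clique $X$ of $R$ and a clique $Y$ of $B$ such that $U=X\cup Y$. For $S\subseteq V$, $G|S$ denotes the subgraph of $G$ induced by $S$. A graph is $H$-free if none of its induced subgraphs is isomorphic to $H$; $C_k$ is the cycle on $k$ vertices. $G(B,R)$ contains a double $C_5$ if there is a set $S\subseteq V$ of five vertices such that $B|S$ and $R|S$ are both isomorphic to $C_5$. *)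

theory Defs
  imports "Graph_Theory.Graph_Theory"
begin

text \<open>A simple graph is a pair digraph satisfying \<^locale>\<open>pair_bidirected_digraph\<close>: its arcs are
  ordered pairs of vertices, symmetric and without loops. Unlike \<^locale>\<open>pair_graph\<close>, this does
  not require finiteness. For \<open>B\<close> and \<open>R\<close> on the same vertex set, \<open>G(B,R)\<close> is
  \<^const>\<open>Digraph_Component.union\<close>.\<close>

text \<open>\<^const>\<open>complete_digraph\<close> fixes a finite number of vertices; this is the same condition on the
  adjacency relation without it.\<close>
definition complete_graph :: "('a, 'b) pre_digraph \<Rightarrow> bool" where
  "complete_graph G \<longleftrightarrow> arcs_ends G = {(u, v). u \<in> verts G \<and> v \<in> verts G \<and> u \<noteq> v}"

definition clique :: "('a, 'b) pre_digraph \<Rightarrow> 'a set \<Rightarrow> bool" where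
  "clique G X \<longleftrightarrow> X \<subseteq> verts G \<and> (\<forall>u\<in>X. \<forall>v\<in>X. u \<noteq> v \<longrightarrow> u \<rightarrow>\<^bsub>G\<^esub> v)"

definition obedient :: "'a pair_pre_digraph \<Rightarrow> 'a pair_pre_digraph \<Rightarrow> 'a set \<Rightarrow> bool" where
  "obedient B R U \<longleftrightarrow> (\<exists>X Y. clique (with_proj R) X \<and> clique (with_proj B) Y \<and> U = X \<union> Y)"

definition induced_free :: "('a, 'b) pre_digraph \<Rightarrow> ('c, 'd) pre_digraph \<Rightarrow> bool" where
  "induced_free H G \<longleftrightarrow> \<not> (\<exists>K. induced_subgraph K G \<and> digraph_iso K H)"

text \<open>The cycle on \<open>{0, \<dots>, k - 1}\<close>; a simple graph, namely \<open>C\<^sub>k\<close>, for \<open>k \<ge> 3\<close>.\<close>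
definition cycle_graph :: "nat \<Rightarrow> nat pair_pre_digraph" where
  "cycle_graph k = \<lparr> pverts = {..<k},
     parcs = {(i, j). i < k \<and> j < k \<and> (j = Suc i mod k \<or> i = Suc j mod k)} \<rparr>"

definition contains_double_C5 :: "'a pair_pre_digraph \<Rightarrow> 'a pair_pre_digraph \<Rightarrow> bool" where
  "contains_double_C5 B R \<longleftrightarrow> (\<exists>S. S \<subseteq> pverts B \<inter> pverts R \<and> card S = 5 \<and>
     digraph_iso (with_proj B \<restriction> S) (with_proj (cycle_graph 5)) \<and>
     digraph_iso (with_proj R \<restriction> S) (with_proj (cycle_graph 5)))"

end

theory Submission
  imports Defs
begin

text \<open>
  A vertex of \<open>V\<close> is to be put either into a clique \<open>X\<close> of \<open>R\<close> or into a clique \<open>Y\<close> of \<open>B\<close>. Two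
  distinct vertices must not both go into \<open>X\<close> if they are nonadjacent in \<open>R\<close>, and not both into
  \<open>Y\<close> if they are nonadjacent in \<open>B\<close>. This is an instance of 2-satisfiability, possibly with
  infinitely many variables. Say that a pair of the first kind conflicts for \<open>X\<close> and one of the
  second kind conflicts for \<open>Y\<close>. No pair does both, because \<open>G(B,R)\<close> is complete. An induced
  four-cycle consists of two disjoint nonadjacent pairs that are completely joined, so
  \<open>C\<^sub>4\<close>-freeness says that any two disjoint pairs conflicting for the same side are linked by a
  third such pair. All further reasoning uses only this property and the exclusion of five vertices
  on which the two conflict graphs are complementary pentagons.

  A vertex is blocked for a side if placing it there leads to a contradiction after three
  steps: two of its conflict partners for that side conflict for the other one. Linking pairs
  shorten longer chains of implications so much that these yield nothing beyond the blocked
  vertices and the vertices pushed to one side by a single blocked neighbour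
  (\<open>forcing_closed\<close>). Two contradictory forcings produce a double pentagon (\<open>not_blocked_both\<close>,
  \<open>blocked_independent\<close>), so the forced positions form a consistent partial assignment that is closed
  under implication. Given any such partial assignment, an undecided vertex can be placed on either
  side: its consequences reach only its neighbours and their neighbours (\<open>zigzag_returns\<close>), and
  none of them disagrees with what is already decided (\<open>partial_assignment_extend\<close>). By Zorn's
  lemma some partial assignment is total, whatever the cardinality of \<open>V\<close>.
\<close>

section \<open>Conflicts between placements\<close>

text \<open>
  The two sides are the truth values. Indexing both conflict graphs by the side makes every
  argument below serve for a side and for its opposite at once.
\<close>
locale conflicts =
  fixes conflict :: "bool \<Rightarrow> 'a \<Rightarrow> 'a \<Rightarrow> bool"
  assumes conflict_sym: "conflict c u v \<Longrightarrow> conflict c v u"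
    and conflict_irrefl: "\<not> conflict c v v"
    and conflict_excl: "conflict c u v \<Longrightarrow> \<not> conflict (\<not> c) u v"
    and linked: "\<lbrakk>conflict c x y; conflict c z w; x \<noteq> z; x \<noteq> w; y \<noteq> z; y \<noteq> w\<rbrakk> \<Longrightarrow>
      conflict c x z \<or> conflict c x w \<or> conflict c y z \<or> conflict c y w"
    and no_double_pentagon:
      "\<lbrakk>conflict c p q; conflict c q r; conflict c r s; conflict c s t; conflict c t p;
        conflict (\<not> c) p r; conflict (\<not> c) r t; conflict (\<not> c) t q; conflict (\<not> c) q s;
        conflict (\<not> c) s p\<rbrakk> \<Longrightarrow> False"
begin

text \<open>
  With \<open>v\<close> on side \<open>c\<close>, both \<open>p\<close> and \<open>q\<close> would have to be on the other side, where they conflict.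
\<close>
definition blocked :: "bool \<Rightarrow> 'a \<Rightarrow> bool" where
  "blocked c v \<longleftrightarrow> (\<exists>p q. conflict c v p \<and> conflict (\<not> c) p q \<and> conflict c q v)"

lemma blockedI: "\<lbrakk>conflict c v p; conflict (\<not> c) p q; conflict c q v\<rbrakk> \<Longrightarrow> blocked c v"
  unfolding blocked_def by blast

section \<open>Forced placements\<close>

text \<open>
  The two triangles that block \<open>v\<close> share only \<open>v\<close>. The linking property, used several times between
  their sides, completes the five vertices to complementary pentagons.
\<close>
lemma not_blocked_both:
  assumes "blocked c v" "blocked (\<not> c) v"
  shows False
proof -
  obtain p q where pq: "conflict c v p" "conflict (\<not> c) p q" "conflict c q v"
    using assms(1) by (auto simp: blocked_def)
  obtain s t where st: "conflict (\<not> c) v s" "conflict c s t" "conflict (\<not> c) t v"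
    using assms(2) by (auto simp: blocked_def)
  (* Up to exchanging p and q, the link between pq and vs ends in p. *)
  have core: False
    if pq: "conflict c v p" "conflict (\<not> c) p q" "conflict c q v"
      and sp: "conflict (\<not> c) p s" for p q
  proof -
    have pt: "conflict c p t"
      using linked[of c v p s t] pq st sp conflict_sym conflict_excl conflict_irrefl by metis
    have qt: "conflict (\<not> c) q t"
      using linked[of "\<not> c" p q v t] pq st pt conflict_sym conflict_excl conflict_irrefl by metis
    have qs: "conflict c q s"
      using linked[of c v q t s] pq st qt conflict_sym conflict_excl conflict_irrefl by metis
    show False
      using no_double_pentagon[of c v p t s q] pq st sp pt qt qs conflict_sym by blast
  qed
  have "conflict (\<not> c) p s \<or> conflict (\<not> c) q s"
    using linked[of "\<not> c" p q v s] pq st conflict_sym conflict_excl conflict_irrefl by metis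
  then show False
    using core pq conflict_sym by blast
qed

text \<open>
  The triangles blocking \<open>u\<close> and \<open>v\<close> may share vertices, but five of the at most six vertices always
  form the complementary pentagons.
\<close>
lemma blocked_independent:
  assumes "blocked c u" "blocked c v"
  shows "\<not> conflict (\<not> c) u v"
proof
  assume uv: "conflict (\<not> c) u v"
  obtain s t where st: "conflict c u s" "conflict (\<not> c) s t" "conflict c t u"
    using assms(1) by (auto simp: blocked_def)
  obtain p q where pq: "conflict c v p" "conflict (\<not> c) p q" "conflict c q v"
    using assms(2) by (auto simp: blocked_def)
  (* The pair uv is linked to pq and to st; p and s name the endpoints of these links. *)
  have core: False
    if pq: "conflict c v p" "conflict (\<not> c) p q" "conflict c q v"
      and st: "conflict c u s" "conflict (\<not> c) s t" "conflict c t u"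
      and pu: "conflict (\<not> c) p u" and sv: "conflict (\<not> c) s v" for p q s t
  proof -
    have ps: "conflict c p s"
      using linked[of c v p u s] pq st uv pu sv conflict_sym conflict_excl conflict_irrefl by metis
    have pt: "conflict (\<not> c) p t"
      using linked[of "\<not> c" s t p u] pq st uv pu ps conflict_sym conflict_excl conflict_irrefl by metis
    have tv: "conflict c t v"
      using linked[of c v p u t] pq st uv pu pt conflict_sym conflict_excl conflict_irrefl by metis
    show False
      using no_double_pentagon[of c v p s u t] pq st uv pu sv ps pt tv conflict_sym by blast
  qed
  have "conflict (\<not> c) p u \<or> conflict (\<not> c) q u"
    using linked[of "\<not> c" p q u v] uv pq conflict_sym conflict_excl conflict_irrefl by metis
  moreover have "conflict (\<not> c) s v \<or> conflict (\<not> c) t v"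
    using linked[of "\<not> c" s t u v] uv st conflict_sym conflict_excl conflict_irrefl by metis
  ultimately show False
    using core pq st conflict_sym by metis
qed

text \<open>
  As \<open>u\<close> is excluded from side \<open>c\<close>, the vertex \<open>w\<close> is forced to side \<open>c\<close> and \<open>z\<close> to the other one.
  The point is that forcing \<open>z\<close> never needs a chain of this length: \<open>z\<close> is blocked itself or
  conflicts with a single vertex, in the proof always \<open>w\<close>, that is blocked on the opposite side.
\<close>
lemma forcing_closed:
  assumes "blocked c u" "conflict (\<not> c) u w" "conflict c w z"
  shows "blocked c z \<or> (\<exists>y. blocked (\<not> c) y \<and> conflict c y z)"
proof (rule ccontr)
  assume neg: "\<not> ?thesis"
  then have nz: "\<not> blocked c z" by blast
  have uw: "conflict (\<not> c) u w" and wz: "conflict c w z" by fact+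
  (* If w conflicts for side c with a vertex of the pair that blocks u, then w is blocked on the
     opposite side. *)
  have core: False
    if pq: "conflict c u p" "conflict (\<not> c) p q" "conflict c q u"
      and c1: "conflict c p w" for p q
  proof -
    have qw: "conflict (\<not> c) q w"
      using linked[of "\<not> c" p q u w] uw pq c1 conflict_sym conflict_excl conflict_irrefl by metis
    have "blocked (\<not> c) w"
      using blockedI[of "\<not> c" w q u] uw qw pq conflict_sym by simp
    then show False using neg wz by blast
  qed
  obtain p q where pq: "conflict c u p" "conflict (\<not> c) p q" "conflict c q u"
    using assms(1) by (auto simp: blocked_def)
  have z: "z \<noteq> u" "z \<noteq> p" "z \<noteq> q"
    using nz blockedI[of c z u w] uw wz pq conflict_sym conflict_excl by metis+
  have p: "conflict c p w \<or> conflict c p z"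
    using linked[of c u p w z] blockedI[of c z u w] nz uw wz pq z conflict_sym conflict_excl conflict_irrefl by metis
  have q: "conflict c q w \<or> conflict c q z"
    using linked[of c u q w z] blockedI[of c z u w] nz uw wz pq z conflict_sym conflict_excl conflict_irrefl by metis
  have "\<not> (conflict c p z \<and> conflict c q z)"
    using blockedI[of c z p q] nz pq conflict_sym by blast
  then show False
    using p q core[of p q] core[of q p] pq conflict_sym by blast
qed


text \<open>Here \<open>c\<close> is the side on which the vertex has to be, not the one from which it is excluded.\<close>
definition forced :: "bool \<Rightarrow> 'a \<Rightarrow> bool" where
  "forced c w \<longleftrightarrow> blocked (\<not> c) w \<or> (\<exists>u. blocked c u \<and> conflict (\<not> c) u w)"

lemma forced_propagates:
  assumes "forced c w" "conflict c w z"
  shows "forced (\<not> c) z"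
  using assms forcing_closed[of c _ w z] unfolding forced_def by auto

text \<open>
  A vertex forced both ways by neighbours only passes its placement on to one of these
  neighbours, which is then both blocked and forced to the side where it is blocked. Hence it is
  enough to refute that situation.
\<close>
lemma not_forced_both:
  assumes "forced c w" "forced (\<not> c) w"
  shows False
proof -
  have excluded: False if "blocked c w" "forced c w" for c w
    using that not_blocked_both blocked_independent unfolding forced_def by blast
  show False
  proof (cases "blocked c w")
    case True
    then show False using assms(1) excluded by blast
  next
    case False
    then obtain u where u: "blocked (\<not> c) u" "conflict c u w"
      using assms(2) unfolding forced_def by auto
    have "forced (\<not> c) u"
      using forced_propagates[OF assms(1)] u(2) conflict_sym by blast
    then show False using excluded u(1) by blast
  qed
qed

section \<open>Extending partial assignments\<close>

text \<open>
  A set of pairs rather than a partial function, so that the union of a chain is again such a set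
  and Zorn's lemma applies to inclusion.
\<close>
definition partial_assignment :: "('a \<times> bool) set \<Rightarrow> bool" where
  "partial_assignment S \<longleftrightarrow>
     (\<forall>v c. blocked c v \<longrightarrow> (v, \<not> c) \<in> S) \<and>
     (\<forall>v c. (v, c) \<in> S \<longrightarrow> (v, \<not> c) \<notin> S) \<and>
     (\<forall>v c w. (v, c) \<in> S \<longrightarrow> conflict c v w \<longrightarrow> (w, \<not> c) \<in> S)"

lemma
  assumes "partial_assignment S"
  shows partial_assignment_blocked: "blocked c v \<Longrightarrow> (v, \<not> c) \<in> S"
    and partial_assignment_consistent: "(v, c) \<in> S \<Longrightarrow> (v, \<not> c) \<notin> S"
    and partial_assignment_closed: "(v, c) \<in> S \<Longrightarrow> conflict c v w \<Longrightarrow> (w, \<not> c) \<in> S"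
  using assms unfolding partial_assignment_def by blast+

text \<open>The closure condition for the side \<open>\<not> c\<close>, with the double negation removed.\<close>
lemma partial_assignment_closed':
  assumes "partial_assignment S" "(w, \<not> c) \<in> S" "conflict (\<not> c) w z"
  shows "(z, c) \<in> S"
  using partial_assignment_closed[OF assms] by simp

lemma partial_assignment_forced: "partial_assignment {(w, c). forced c w}"
proof -
  have "forced (\<not> c) v" if "blocked c v" for v c
    using that by (simp add: forced_def)
  then show ?thesis
    unfolding partial_assignment_def
    using forced_propagates not_forced_both by blast
qed

lemma partial_assignment_Union:
  assumes "\<C> \<noteq> {}" "subset.chain {S. partial_assignment S} \<C>"
  shows "partial_assignment (\<Union>\<C>)"
proof -
  have pa: "partial_assignment S" if "S \<in> \<C>" for S
    using assms(2) that unfolding subset.chain_def by blast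
  have common: "\<exists>S\<in>\<C>. x \<in> S \<and> y \<in> S" if "x \<in> \<Union>\<C>" "y \<in> \<Union>\<C>" for x y
    using assms(2) that unfolding subset_chain_def by blast
  have "(v, \<not> c) \<notin> \<Union>\<C>" if "(v, c) \<in> \<Union>\<C>" for v c
    using common[OF that] pa partial_assignment_consistent by blast
  moreover have "(v, \<not> c) \<in> \<Union>\<C>" if "blocked c v" for v c
    using that assms(1) pa partial_assignment_blocked by blast
  moreover have "(w, \<not> c) \<in> \<Union>\<C>" if "(v, c) \<in> \<Union>\<C>" "conflict c v w" for v c w
    using that pa partial_assignment_closed by blast
  ultimately show ?thesis unfolding partial_assignment_def by blast
qed

text \<open>
  Placing \<open>v\<close> on side \<open>c\<close> forces \<open>u\<close>, \<open>w\<close> and \<open>z\<close> in turn. The pairs \<open>vu\<close> and \<open>wz\<close> are linked, and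
  every possible link shows that the placement of \<open>z\<close> follows directly from that of \<open>v\<close>, or is
  forced anyway. So implications from \<open>v\<close> need to be followed for two steps only.
\<close>
lemma zigzag_returns:
  assumes "\<not> blocked c v" "conflict c v u" "conflict (\<not> c) u w" "conflict c w z"
  shows "conflict c v z \<or> blocked c z"
proof -
  have nvw: "\<not> conflict c v w"
    using assms blockedI conflict_sym by blast
  have "v \<noteq> w" "u \<noteq> z" "v \<noteq> z"
    using assms nvw conflict_excl conflict_sym by blast+
  then have "conflict c v z \<or> conflict c u z"
    using linked[of c v u w z] assms nvw conflict_excl conflict_irrefl by metis
  moreover have "blocked c z" if "conflict c u z"
    using blockedI[of c z u w] assms that conflict_sym by blast
  ultimately show ?thesis by blast
qed

text \<open>
  The consequences of the new placement are consistent with \<open>S\<close> because implications can be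
  reversed: a consequence contradicting \<open>S\<close> would already have decided \<open>v\<close> in \<open>S\<close>.
\<close>
lemma partial_assignment_extend:
  assumes S: "partial_assignment S" and v: "(v, c) \<notin> S" "(v, \<not> c) \<notin> S"
  obtains S' where "partial_assignment S'" "S \<subseteq> S'" "(v, c) \<in> S'"
proof -
  define N where "N = {u. conflict c v u}"
  define P where "P = insert v {w. \<exists>u\<in>N. conflict (\<not> c) u w}"
  define S' where "S' = S \<union> P \<times> {c} \<union> N \<times> {\<not> c}"
  have nb: "\<not> blocked c v"
    using partial_assignment_blocked[OF S] v(2) by blast
  have mem: "(x, c) \<in> S' \<longleftrightarrow> (x, c) \<in> S \<or> x \<in> P" "(x, \<not> c) \<in> S' \<longleftrightarrow> (x, \<not> c) \<in> S \<or> x \<in> N" for x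
    unfolding S'_def by auto
  have N: "(x, c) \<notin> S" if "x \<in> N" for x
    using partial_assignment_closed[OF S, of x c v] that v(2) conflict_sym unfolding N_def by blast
  have P: "(x, \<not> c) \<notin> S" if "x \<in> P" for x
    using partial_assignment_closed'[OF S, of x c] that v(2) N conflict_sym unfolding P_def by blast
  have disj: "x \<notin> N" if "x \<in> P" for x
    using that nb blockedI[of c v] conflict_irrefl conflict_sym unfolding P_def N_def by blast
  have consistent: "\<not> ((x, c) \<in> S' \<and> (x, \<not> c) \<in> S')" for x
    using mem N P disj partial_assignment_consistent[OF S] by blast
  have closed: "(y, \<not> c) \<in> S'" if xy: "(x, c) \<in> S'" "conflict c x y" for x y
  proof -
    have "y \<in> N \<or> blocked c y" if "x \<in> P"
      using that xy(2) zigzag_returns[OF nb] unfolding P_def N_def by blast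
    then show ?thesis
      using xy mem partial_assignment_blocked[OF S] partial_assignment_closed[OF S] by blast
  qed
  have closed': "(y, c) \<in> S'" if xy: "(x, \<not> c) \<in> S'" "conflict (\<not> c) x y" for x y
    using xy mem partial_assignment_closed'[OF S] unfolding P_def by blast
  have "partial_assignment S'"
    unfolding partial_assignment_def
  proof (intro conjI allI impI)
    fix x d assume "blocked d x"
    then show "(x, \<not> d) \<in> S'"
      using partial_assignment_blocked[OF S] unfolding S'_def by blast
  next
    fix x d assume "(x, d) \<in> S'"
    then show "(x, \<not> d) \<notin> S'"
      using consistent[of x] by (cases "d = c") auto
  next
    fix x d y assume "(x, d) \<in> S'" "conflict d x y"
    then show "(y, \<not> d) \<in> S'"
      using closed closed' by (cases "d = c") auto
  qed
  moreover have "S \<subseteq> S'" "(v, c) \<in> S'"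
    unfolding S'_def P_def by auto
  ultimately show thesis using that by blast
qed

lemma conflict_free_partition:
  obtains f :: "'a \<Rightarrow> bool" where "\<And>u v c. f u = c \<Longrightarrow> f v = c \<Longrightarrow> \<not> conflict c u v"
proof -
  have "\<exists>M\<in>{S. partial_assignment S}. \<forall>X\<in>{S. partial_assignment S}. M \<subseteq> X \<longrightarrow> X = M"
    using partial_assignment_forced partial_assignment_Union
    by (intro subset_Zorn_nonempty) auto
  then obtain M where M: "partial_assignment M"
    and max: "\<And>X. partial_assignment X \<Longrightarrow> M \<subseteq> X \<Longrightarrow> X = M" by blast
  have total: "(v, True) \<in> M \<or> (v, False) \<in> M" for v
    using partial_assignment_extend[OF M, of v True] max by auto
  define f where "f v \<longleftrightarrow> (v, True) \<in> M" for v
  have f: "(v, c) \<in> M \<longleftrightarrow> f v = c" for v c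
    using total[of v] partial_assignment_consistent[OF M, of v True] unfolding f_def
    by (cases c) auto
  show thesis
    using that partial_assignment_closed[OF M] unfolding f by blast
qed

end

section \<open>Induced cycles from adjacency tables\<close>

lemma induced_cycle_iso:
  assumes "pair_wf_digraph G" "distinct xs" "length xs = k" "set xs \<subseteq> pverts G"
    and arcs: "\<And>i j. i < k \<Longrightarrow> j < k \<Longrightarrow>
      (xs ! i, xs ! j) \<in> parcs G \<longleftrightarrow> j = Suc i mod k \<or> i = Suc j mod k"
  shows "digraph_iso (with_proj G \<restriction> set xs) (with_proj (cycle_graph k))"
proof -
  interpret pair_wf_digraph G by fact
  define g where "g = the_inv_into {..<k} ((!) xs)"
  have inj: "inj_on ((!) xs) {..<k}"
    using assms(2,3) by (simp add: inj_on_nth)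
  have set: "set xs = (!) xs ` {..<k}"
    using assms(3) by (auto simp: set_conv_nth)
  have g: "g (xs ! i) = i" if "i < k" for i
    unfolding g_def using that the_inv_into_f_f[OF inj] by simp
  (* The isomorphism sends each vertex to its position in the list. *)
  have img: "g ` set xs = {..<k}" unfolding set by (force simp: g image_image)
  have inj_g: "inj_on g (set xs)" unfolding set inj_on_def by (auto simp: g)
  define h where "h = \<lparr>iso_verts = g, iso_arcs = map_prod g g, iso_head = snd, iso_tail = fst\<rparr>"
  have sub: "arcs (with_proj G \<restriction> set xs) \<subseteq> set xs \<times> set xs" by auto
  have "pre_digraph.digraph_isomorphism (with_proj G \<restriction> set xs) h"
    unfolding pre_digraph.digraph_isomorphism_def
  proof (intro conjI)
    show "wf_digraph (with_proj G \<restriction> set xs)" using assms(4) by (intro wellformed_induce_subgraph)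
    show "inj_on (iso_arcs h) (arcs (with_proj G \<restriction> set xs))"
      using inj_on_subset[OF map_prod_inj_on[OF inj_g inj_g] sub] by (simp add: h_def)
  qed (use inj_g in \<open>auto simp: h_def\<close>)
  moreover have "with_proj (cycle_graph k) = app_iso h (with_proj G \<restriction> set xs)"
  proof -
    have "map_prod g g ` {e \<in> parcs G. fst e \<in> set xs \<and> snd e \<in> set xs} = parcs (cycle_graph k)"
    proof (intro equalityI subsetI)
      fix e assume "e \<in> parcs (cycle_graph k)"
      then obtain i j where ij: "e = (i, j)" "i < k" "j < k" "j = Suc i mod k \<or> i = Suc j mod k"
        by (auto simp: cycle_graph_def)
      then have "(xs ! i, xs ! j) \<in> parcs G" using arcs by blast
      moreover have "e = map_prod g g (xs ! i, xs ! j)" using ij(1-3) g by simp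
      ultimately show "e \<in> map_prod g g ` {e \<in> parcs G. fst e \<in> set xs \<and> snd e \<in> set xs}"
        using ij(2,3) assms(3) by (intro image_eqI[where x = "(xs ! i, xs ! j)"]) simp_all
    next
      fix e assume "e \<in> map_prod g g ` {e \<in> parcs G. fst e \<in> set xs \<and> snd e \<in> set xs}"
      then obtain i j where "i < k" "j < k" "(xs ! i, xs ! j) \<in> parcs G" "e = (i, j)"
        unfolding set by (auto simp: g)
      then show "e \<in> parcs (cycle_graph k)" using arcs by (auto simp: cycle_graph_def)
    qed
    then show ?thesis
      using img by (simp add: app_iso_def h_def with_proj_def induce_subgraph_def cycle_graph_def)
  qed
  ultimately show ?thesis unfolding digraph_iso_def by blast
qed

lemma bidirected_arc_sym:
  assumes "pair_bidirected_digraph G" "(u, v) \<in> parcs G"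
  shows "(v, u) \<in> parcs G"
proof -
  interpret pair_bidirected_digraph G by fact
  show ?thesis using pair_sym_arcs assms(2) by (auto simp: symmetric_def sym_def)
qed

text \<open>The four vertices would span the cycle \<open>x z y w\<close>, whose diagonals are \<open>xy\<close> and \<open>zw\<close>.\<close>
lemma C4_free_nonadjacent_pairs:
  assumes G: "pair_bidirected_digraph G"
    and free: "induced_free (with_proj (cycle_graph 4)) (with_proj G)"
    and arcs: "(x, z) \<in> parcs G" "(x, w) \<in> parcs G" "(y, z) \<in> parcs G" "(y, w) \<in> parcs G"
    and non: "(x, y) \<notin> parcs G" "(z, w) \<notin> parcs G"
    and neq: "x \<noteq> y" "z \<noteq> w"
  shows False
proof -
  interpret pair_bidirected_digraph G by fact
  have sym: "(v, u) \<in> parcs G" if "(u, v) \<in> parcs G" for u v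
    using bidirected_arc_sym[OF G that] .
  have nsym: "(v, u) \<notin> parcs G" if "(u, v) \<notin> parcs G" for u v
    using that sym by blast
  have loop: "(u, u) \<notin> parcs G" for u using pair_no_loops by force
  let ?xs = "[x, z, y, w]"
  have sub: "set ?xs \<subseteq> pverts G" using arcs in_arcsD1 in_arcsD2 by auto
  have "digraph_iso (with_proj G \<restriction> set ?xs) (with_proj (cycle_graph 4))"
  proof (rule induced_cycle_iso)
    show "pair_wf_digraph G" by unfold_locales
    show "distinct ?xs" using arcs neq loop by auto
    show "(?xs ! i, ?xs ! j) \<in> parcs G \<longleftrightarrow> j = Suc i mod 4 \<or> i = Suc j mod 4"
      if "i < 4" "j < 4" for i j
    proof -
      have "i = 0 \<or> i = 1 \<or> i = 2 \<or> i = 3" "j = 0 \<or> j = 1 \<or> j = 2 \<or> j = 3"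
        using that by linarith+
      then show ?thesis
        by (elim disjE) (simp_all add: loop arcs arcs[THEN sym] non non[THEN nsym])
    qed
  qed (use sub in auto)
  moreover have "induced_subgraph (with_proj G \<restriction> set ?xs) (with_proj G)"
    using sub by (intro induced_induce)
  ultimately show False using free unfolding induced_free_def by blast
qed

lemma induced_pentagon_iso:
  assumes G: "pair_bidirected_digraph G"
    and arcs: "(p, q) \<in> parcs G" "(q, r) \<in> parcs G" "(r, s) \<in> parcs G" "(s, t) \<in> parcs G"
      "(t, p) \<in> parcs G"
    and non: "(p, r) \<notin> parcs G" "(r, t) \<notin> parcs G" "(t, q) \<notin> parcs G" "(q, s) \<notin> parcs G"
      "(s, p) \<notin> parcs G"
    and dist: "distinct [p, q, r, s, t]"
  shows "digraph_iso (with_proj G \<restriction> {p, q, r, s, t}) (with_proj (cycle_graph 5))"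
proof -
  interpret pair_bidirected_digraph G by fact
  have sym: "(v, u) \<in> parcs G" if "(u, v) \<in> parcs G" for u v
    using bidirected_arc_sym[OF G that] .
  have nsym: "(v, u) \<notin> parcs G" if "(u, v) \<notin> parcs G" for u v
    using that sym by blast
  have loop: "(u, u) \<notin> parcs G" for u using pair_no_loops by force
  let ?xs = "[p, q, r, s, t]"
  have sub: "set ?xs \<subseteq> pverts G" using arcs in_arcsD1 in_arcsD2 by auto
  have "digraph_iso (with_proj G \<restriction> set ?xs) (with_proj (cycle_graph 5))"
  proof (rule induced_cycle_iso)
    show "pair_wf_digraph G" by unfold_locales
    show "(?xs ! i, ?xs ! j) \<in> parcs G \<longleftrightarrow> j = Suc i mod 5 \<or> i = Suc j mod 5"
      if "i < 5" "j < 5" for i j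
    proof -
      have "i = 0 \<or> i = 1 \<or> i = 2 \<or> i = 3 \<or> i = 4" "j = 0 \<or> j = 1 \<or> j = 2 \<or> j = 3 \<or> j = 4"
        using that by linarith+
      then show ?thesis
        by (elim disjE) (simp_all add: loop arcs arcs[THEN sym] non non[THEN nsym])
    qed
  qed (use sub dist in auto)
  then show ?thesis by simp
qed

section \<open>Obedience of the vertex set\<close>

text \<open>
  The clique of \<open>R\<close> is the side \<open>True\<close>, the clique of \<open>B\<close> the side \<open>False\<close>. As the union of the two
  graphs is complete, a pair that conflicts for one side is adjacent in the graph of the other side.
\<close>
lemma conflicts_nonadjacency:
  fixes B R :: "'a pair_pre_digraph"
  assumes "pair_bidirected_digraph B" and "pair_bidirected_digraph R"
    and "pverts B = V" and "pverts R = V"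
    and "induced_free (with_proj (cycle_graph 4)) (with_proj B)"
    and "induced_free (with_proj (cycle_graph 4)) (with_proj R)"
    and "complete_graph (Digraph_Component.union (with_proj B) (with_proj R))"
    and "\<not> contains_double_C5 B R"
  shows "conflicts (\<lambda>c u v. u \<in> V \<and> v \<in> V \<and> u \<noteq> v \<and> (u, v) \<notin> parcs (if c then R else B))"
proof -
  define G where "G c = (if c then R else B)" for c
  define conflict where "conflict c u v \<longleftrightarrow> u \<in> V \<and> v \<in> V \<and> u \<noteq> v \<and> (u, v) \<notin> parcs (G c)" for c u v
  have G: "pair_bidirected_digraph (G c)" "pverts (G c) = V"
    "induced_free (with_proj (cycle_graph 4)) (with_proj (G c))" for c
    using assms(1-6) by (simp_all add: G_def)
  have complete: "(u, v) \<in> parcs B \<or> (u, v) \<in> parcs R" if "u \<in> V" "v \<in> V" "u \<noteq> v" for u v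
  proof -
    have "(u, v) \<in> arcs_ends (Digraph_Component.union (with_proj B) (with_proj R))"
      using assms(3,4,7) that unfolding complete_graph_def by (simp add: union_def)
    then show ?thesis by (auto simp: arcs_ends_conv union_def)
  qed
  have opposite: "(u, v) \<in> parcs (G (\<not> c))" if "conflict c u v" for c u v
    using that complete[of u v] by (cases c) (simp_all add: conflict_def G_def)
  have nonarc: "(u, v) \<notin> parcs (G c)" "u \<noteq> v" "u \<in> V" "v \<in> V" if "conflict c u v" for c u v
    using that by (simp_all add: conflict_def)
  have sym: "conflict c v u" if "conflict c u v" for c u v
    using that bidirected_arc_sym[OF G(1), of v u c] unfolding conflict_def by blast
  have "conflicts conflict"
  proof
    show "conflict c v u" if "conflict c u v" for c u v
      using sym[OF that] .
    show "\<not> conflict c v v" for c v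
      by (simp add: conflict_def)
    show "\<not> conflict (\<not> c) u v" if "conflict c u v" for c u v
      using opposite[OF that] by (simp add: conflict_def)
    show "conflict c x z \<or> conflict c x w \<or> conflict c y z \<or> conflict c y w"
      if "conflict c x y" "conflict c z w" "x \<noteq> z" "x \<noteq> w" "y \<noteq> z" "y \<noteq> w" for c x y z w
      using that C4_free_nonadjacent_pairs[OF G(1,3), of x z c w y] unfolding conflict_def by blast
    show False
      if c: "conflict c p q" "conflict c q r" "conflict c r s" "conflict c s t" "conflict c t p"
        and d: "conflict (\<not> c) p r" "conflict (\<not> c) r t" "conflict (\<not> c) t q"
        "conflict (\<not> c) q s" "conflict (\<not> c) s p" for c p q r s t
    proof -
      let ?S = "{p, q, r, s, t}"
      have dist: "distinct [p, q, r, s, t]" "distinct [p, r, t, q, s]"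
        using c[THEN nonarc(2)] d[THEN nonarc(2)] by auto
      (* A conflict in one graph is an arc of the other, so each graph sees a pentagon; for G c
         it is the pentagram p r t q s. *)
      have "digraph_iso (with_proj (G (\<not> c)) \<restriction> ?S) (with_proj (cycle_graph 5))"
        by (rule induced_pentagon_iso[OF G(1) c[THEN opposite] d[THEN nonarc(1)] dist(1)])
      moreover have "digraph_iso (with_proj (G c) \<restriction> {p, r, t, q, s}) (with_proj (cycle_graph 5))"
        by (rule induced_pentagon_iso[OF G(1) d[THEN opposite, unfolded not_not]
            c(5,4,3,2,1)[THEN sym, THEN nonarc(1)] dist(2)])
      moreover have "{p, r, t, q, s} = ?S"
        by (simp add: insert_commute)
      moreover have "card ?S = 5"
        using distinct_card[OF dist(1)] by simp
      moreover have "?S \<subseteq> pverts B \<inter> pverts R"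
        using c[THEN nonarc(3)] assms(3,4) by simp
      ultimately show False
        using assms(8) unfolding contains_double_C5_def G_def by (cases c) auto
    qed
  qed
  then show ?thesis
    unfolding conflict_def G_def .
qed

theorem theorem3p1:
  fixes B R :: "'a pair_pre_digraph" and V :: "'a set"
  assumes "pair_bidirected_digraph B" and "pair_bidirected_digraph R"
    and "pverts B = V" and "pverts R = V"
    and "induced_free (with_proj (cycle_graph 4)) (with_proj B)"
    and "induced_free (with_proj (cycle_graph 4)) (with_proj R)"
    and "complete_graph (Digraph_Component.union (with_proj B) (with_proj R))"
    and "\<not> contains_double_C5 B R"
  shows "obedient B R V"
proof -
  obtain f :: "'a \<Rightarrow> bool" where f: "\<And>u v c. f u = c \<Longrightarrow> f v = c \<Longrightarrow>
      \<not> (u \<in> V \<and> v \<in> V \<and> u \<noteq> v \<and> (u, v) \<notin> parcs (if c then R else B))"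
    using conflicts.conflict_free_partition[OF conflicts_nonadjacency[OF assms]] by blast
  have "clique (with_proj R) {v \<in> V. f v}" "clique (with_proj B) {v \<in> V. \<not> f v}"
    using f[of _ True] f[of _ False] assms(3,4) by (auto simp: clique_def)
  moreover have "V = {v \<in> V. f v} \<union> {v \<in> V. \<not> f v}" by blast
  ultimately show ?thesis unfolding obedient_def by blast
qed

end
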